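(* Let $k$ be a domain, let $m\ge n\ge 1$, let $k[\mathbf{x}]=k[x_1,\ldots,x_n]$ and $k[\overline{\mathbf{x}}]=k[x_1,\ldots,x_m]$ be polynomial rings over $k$, and let $\Gamma$ be a totally ordered additive group. Let $f_1,\ldots,f_m\in k[\overline{\mathbf{x}}]$ be such that $k[f_1,\ldots,f_m]=k[\overline{\mathbf{x}}]$ and $k[\mathbf{x}]$ is not contained in $k[f_2,\ldots,f_m]$, and let $S\subset k[\mathbf{x}]\setminus\{0\}$ be a subset such that $\operatorname{trans.deg}_k k[S]=n$. Then for each $\mathbf{w}\in\Gamma^n$ there exists $g\in S$ such that $g$ does not divide $f^{\mathbf{w}}$ (in $k[\mathbf{x}]$) for any $f\in (k[f_2,\ldots,f_m]\cap k[\mathbf{x}])\setminus\{0\}$.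
   Context: "Domain" means commutative integral domain. A totally ordered additive group is an additive (abelian) group $\Gamma$ equipped with a total ordering such that $\alpha\le\beta$ implies $\alpha+\gamma\le\beta+\gamma$ for all $\alpha,\beta,\gamma\in\Gamma$. For $\mathbf{w}=(w_1,\ldots,w_n)\in\Gamma^n$, write $a\cdot\mathbf{w}=a_1w_1+\cdots+a_nw_n$ for $a\in\mathbf{Z}^n$. For nonzero $f=\sum_a u_a x_1^{a_1}\cdots x_n^{a_n}\in k[\mathbf{x}]$ with $u_a\in k$, put $\operatorname{supp}(f)=\{a\mid u_a\neq 0\}$ and $\deg_{\mathbf{w}}f=\max\{a\cdot\mathbf{w}\mid a\in\operatorname{supp}(f)\}$; the $\mathbf{w}$-initial form $f^{\mathbf{w}}$ is the sum of the terms $u_ax_1^{a_1}\cdots x_n^{a_n}$ of $f$ with $a\in \operatorname{supp}(f)$ and $a\cdot\mathbf{w}=\deg_{\mathbf{w}}f$. $\operatorname{trans.deg}_k k[S]$ is the transcendence degree over $k$ of the $k$-subalgebra $k[S]$ of $k[\mathbf{x}]$ generated by $S$. *)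

theory Defs
  imports "HOL-Library.Poly_Mapping" "HOL-Library.Extended_Nat"
begin

text \<open>Polynomials over \<open>'a\<close> in variables of type \<open>'v\<close>: finitely supported maps from exponent
  vectors to coefficients, with the convolution product of \<^theory>\<open>HOL-Library.Poly_Mapping\<close>.\<close>

type_synonym ('v, 'a) mpol = "('v \<Rightarrow>\<^sub>0 nat) \<Rightarrow>\<^sub>0 'a"

abbreviation const :: "'a::zero \<Rightarrow> ('v, 'a) mpol" where
  "const c \<equiv> Poly_Mapping.single 0 c"

text \<open>The polynomial ring in the variables \<open>V\<close>, inside the ring of polynomials in all
  variables of type \<open>'v\<close>. Rings with fewer variables are thus literally subsets of rings
  with more variables.\<close>

definition poly_ring :: "'v set \<Rightarrow> ('v, 'a::zero) mpol set" where
  "poly_ring V = {p. \<forall>a \<in> Poly_Mapping.keys p. Poly_Mapping.keys a \<subseteq> V}"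

inductive_set subalg :: "('v, 'a::comm_ring_1) mpol set \<Rightarrow> ('v, 'a) mpol set"
  for S :: "('v, 'a) mpol set" where
  const: "const c \<in> subalg S"
| gen: "s \<in> S \<Longrightarrow> s \<in> subalg S"
| add: "p \<in> subalg S \<Longrightarrow> q \<in> subalg S \<Longrightarrow> p + q \<in> subalg S"
| mult: "p \<in> subalg S \<Longrightarrow> q \<in> subalg S \<Longrightarrow> p * q \<in> subalg S"

definition subst :: "('u \<Rightarrow> ('v, 'a::comm_ring_1) mpol) \<Rightarrow> ('u, 'a) mpol \<Rightarrow> ('v, 'a) mpol" where
  "subst \<phi> P = (\<Sum>a \<in> Poly_Mapping.keys P.
     const (Poly_Mapping.lookup P a)
       * (\<Prod>i \<in> Poly_Mapping.keys a. \<phi> i ^ Poly_Mapping.lookup a i))"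

text \<open>Algebraic independence over the coefficient ring. The elements of \<open>B\<close> themselves index
  the variables of the relation \<open>P\<close>, and each variable is evaluated at its own index.\<close>

definition alg_indep :: "('v, 'a::comm_ring_1) mpol set \<Rightarrow> bool" where
  "alg_indep B \<longleftrightarrow>
     (\<forall>P :: (('v, 'a) mpol, 'a) mpol. P \<in> poly_ring B \<longrightarrow> subst (\<lambda>b. b) P = 0 \<longrightarrow> P = 0)"

text \<open>The supremum of the sizes of algebraically independent sets. Over a domain this is the
  transcendence degree of the field of fractions of \<open>A\<close> over that of the coefficient ring.\<close>

definition trdeg :: "('v, 'a::idom) mpol set \<Rightarrow> enat" where
  "trdeg A = (SUP B \<in> {B. B \<subseteq> A \<and> finite B \<and> alg_indep B}. enat (card B))"

text \<open>The pairing of an exponent vector with a weight vector. An ordered group carries no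
  multiplication, so the multiple \<open>a\<^sub>i w\<^sub>i\<close> is written as a repeated sum. Only the
  weights of variables occurring in the exponent matter.\<close>

definition wdot :: "('v \<Rightarrow>\<^sub>0 nat) \<Rightarrow> ('v \<Rightarrow> 'g::ab_group_add) \<Rightarrow> 'g" where
  "wdot a w = (\<Sum>i \<in> Poly_Mapping.keys a. \<Sum>_ < Poly_Mapping.lookup a i. w i)"

text \<open>Meaningful only for nonzero polynomials.\<close>

definition wdeg :: "('v \<Rightarrow> 'g::linordered_ab_group_add) \<Rightarrow> ('v, 'a::zero) mpol \<Rightarrow> 'g" where
  "wdeg w f = Max ((\<lambda>a. wdot a w) ` Poly_Mapping.keys f)"

definition initial_form ::
    "('v \<Rightarrow> 'g::linordered_ab_group_add) \<Rightarrow> ('v, 'a::comm_ring_1) mpol \<Rightarrow> ('v, 'a) mpol" where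
  "initial_form w f =
     (\<Sum>a \<in> {a \<in> Poly_Mapping.keys f. wdot a w = wdeg w f}.
        Poly_Mapping.single a (Poly_Mapping.lookup f a))"

definition dvd_in :: "('v, 'a::comm_ring_1) mpol set \<Rightarrow> ('v, 'a) mpol \<Rightarrow> ('v, 'a) mpol \<Rightarrow> bool" where
  "dvd_in R g p \<longleftrightarrow> (\<exists>h \<in> R. p = g * h)"

end

theory Submission
  imports Defs "HOL-Library.FuncSet"
begin

text \<open>
  The polynomials \<open>f\<^sub>1, \<dots>, f\<^sub>m\<close> generate the polynomial ring, and a surjective endomorphism of a
  polynomial ring in finitely many variables is injective (\<open>surjective_subst_injective\<close>). So
  they are coordinates, and there is a homomorphism \<open>\<Phi>\<close> into the polynomials in one more variable
  \<open>t\<close> that sends \<open>f\<^sub>1\<close> to \<open>f\<^sub>1 + t\<close> and fixes \<open>f\<^sub>2, \<dots>, f\<^sub>m\<close> (\<open>translation_of_coordinate\<close>). It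
  fixes \<open>k[f\<^sub>2, \<dots>, f\<^sub>m]\<close>, it becomes the identity at \<open>t = 0\<close>, and it moves some \<open>x\<^sub>i\<close> with
  \<open>i \<le> n\<close>, since \<open>k[f\<^sub>2, \<dots>, f\<^sub>m]\<close> does not contain all of these. It takes the place of a locally nilpotent derivation and works in every
  characteristic.

  The next step is to pass to leading terms. There is a weight of \<open>t\<close> for which, for each
  \<open>i \<le> n\<close>, no term of \<open>\<Phi> x\<^sub>i\<close> has larger weight than \<open>x\<^sub>i\<close>, while some term of positive degree
  in \<open>t\<close> attains the weight of its \<open>x\<^sub>i\<close>. Keeping in each \<open>\<Phi> x\<^sub>i\<close> the terms of the weight of \<open>x\<^sub>i\<close>
  gives a homomorphism \<open>\<Psi>\<close> that is still the identity at \<open>t = 0\<close> and still involves \<open>t\<close>. The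
  leading part of \<open>\<Phi> p\<close> is \<open>\<Psi>\<close> applied to the initial form of \<open>p\<close>, so \<open>\<Psi>\<close> fixes the initial
  form of each \<open>p\<close> that \<open>\<Phi>\<close> fixes (\<open>initial_form_of_deformation\<close>).

  Because degrees in \<open>t\<close> add up in products, a divisor of a nonzero polynomial fixed by \<open>\<Psi>\<close> is
  fixed by \<open>\<Psi>\<close> too (\<open>divisor_of_invariant_is_invariant\<close>). Hence, if every \<open>g\<close> in \<open>S\<close> divided
  the initial form of some polynomial fixed by \<open>\<Phi>\<close>, all of \<open>k[S]\<close> would be fixed by \<open>\<Psi>\<close>. But \<open>k[S]\<close>
  contains \<open>n\<close> algebraically independent elements, every \<open>x\<^sub>i\<close> is algebraic over them, and an
  element of a domain that is algebraic over polynomials free of \<open>t\<close> is itself free of \<open>t\<close>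
  (\<open>invariants_algebraically_closed\<close>). So \<open>\<Psi>\<close> would not involve \<open>t\<close>, a contradiction.

  Both facts on algebraic dependence, the dependence of \<open>n + 1\<close> polynomials in \<open>n\<close> variables and
  the injectivity of surjective endomorphisms, come down to one remark on linear systems over
  a domain: with more unknowns than equations there is a nontrivial solution.
\<close>

section \<open>Polynomials and substitution\<close>

lemma sum_single_keys:
  fixes p :: "'a \<Rightarrow>\<^sub>0 'b::comm_monoid_add"
  shows "(\<Sum>a\<in>Poly_Mapping.keys p. Poly_Mapping.single a (Poly_Mapping.lookup p a)) = p"
  by (rule poly_mapping_eqI)
    (simp add: lookup_sum lookup_single when_def in_keys_iff sum.delta[of "Poly_Mapping.keys p"])

lemma poly_mapping_terms_induct [consumes 1, case_names zero single add]:
  fixes p :: "'a \<Rightarrow>\<^sub>0 'b::comm_monoid_add"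
  assumes "Poly_Mapping.keys p \<subseteq> K"
    and "P 0"
    and "\<And>a c. a \<in> K \<Longrightarrow> P (Poly_Mapping.single a c)"
    and "\<And>p q. P p \<Longrightarrow> P q \<Longrightarrow> P (p + q)"
  shows "P p"
proof -
  have "P (\<Sum>a\<in>F. Poly_Mapping.single a (Poly_Mapping.lookup p a))" if "finite F" "F \<subseteq> K" for F
    using that by (induction F rule: finite_induct) (auto intro: assms)
  from this[OF finite_keys assms(1)] show ?thesis by (simp add: sum_single_keys)
qed

lemmas terms_induct = poly_mapping_terms_induct[OF subset_UNIV, case_names zero single add]

lemma keys_plus_nat: "Poly_Mapping.keys (a + b :: 'v \<Rightarrow>\<^sub>0 nat) = Poly_Mapping.keys a \<union> Poly_Mapping.keys b"
  by (auto simp: in_keys_iff lookup_add)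

definition Var :: "'v \<Rightarrow> ('v, 'a::comm_ring_1) mpol" where
  "Var i = Poly_Mapping.single (Poly_Mapping.single i 1) 1"

definition power_prod :: "('u \<Rightarrow> ('v, 'a::comm_ring_1) mpol) \<Rightarrow> ('u \<Rightarrow>\<^sub>0 nat) \<Rightarrow> ('v, 'a) mpol" where
  "power_prod \<phi> a = (\<Prod>i\<in>Poly_Mapping.keys a. \<phi> i ^ Poly_Mapping.lookup a i)"

lemma power_prod_superset:
  assumes "finite F" "Poly_Mapping.keys a \<subseteq> F"
  shows "power_prod \<phi> a = (\<Prod>i\<in>F. \<phi> i ^ Poly_Mapping.lookup a i)"
  unfolding power_prod_def
  by (rule prod.mono_neutral_left) (use assms in \<open>auto simp: in_keys_iff\<close>)

lemma power_prod_add: "power_prod \<phi> (a + b) = power_prod \<phi> a * power_prod \<phi> b"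
proof -
  let ?F = "Poly_Mapping.keys a \<union> Poly_Mapping.keys b"
  show ?thesis
    by (simp add: power_prod_superset[of ?F] keys_plus_nat lookup_add power_add prod.distrib)
qed

lemma power_prod_0 [simp]: "power_prod \<phi> 0 = 1"
  by (simp add: power_prod_def)

lemma power_prod_single: "power_prod \<phi> (Poly_Mapping.single i k) = \<phi> i ^ k"
  by (simp add: power_prod_def)

lemma power_prod_cong:
  "(\<And>i. i \<in> Poly_Mapping.keys a \<Longrightarrow> \<phi> i = \<psi> i) \<Longrightarrow> power_prod \<phi> a = power_prod \<psi> a"
  by (simp add: power_prod_def)

lemma subst_superset:
  assumes "finite F" "Poly_Mapping.keys p \<subseteq> F"
  shows "subst \<phi> p = (\<Sum>a\<in>F. const (Poly_Mapping.lookup p a) * power_prod \<phi> a)"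
  unfolding subst_def power_prod_def
  by (rule sum.mono_neutral_left) (use assms in \<open>auto simp: in_keys_iff\<close>)

lemma subst_0 [simp]: "subst \<phi> 0 = 0"
  by (simp add: subst_def)

lemma subst_add: "subst \<phi> (p + q) = subst \<phi> p + subst \<phi> q"
proof -
  let ?F = "Poly_Mapping.keys p \<union> Poly_Mapping.keys q"
  show ?thesis
    using Poly_Mapping.keys_add[of p q]
    by (simp add: subst_superset[of ?F] lookup_add single_add distrib_right sum.distrib)
qed

lemma subst_sum: "subst \<phi> (\<Sum>x\<in>X. p x) = (\<Sum>x\<in>X. subst \<phi> (p x))"
  by (induction X rule: infinite_finite_induct) (simp_all add: subst_add)

lemma subst_single: "subst \<phi> (Poly_Mapping.single a c) = const c * power_prod \<phi> a"
  by (simp add: subst_superset[of "{a}"])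

lemma subst_const [simp]: "subst \<phi> (const c) = const c"
  by (simp add: subst_single)

lemma subst_Var [simp]: "subst \<phi> (Var i) = \<phi> i"
  by (simp add: Var_def subst_single power_prod_single)

lemma const_mult: "const (c * d) = const c * (const d :: ('v, 'a::comm_ring_1) mpol)"
  by (simp add: mult_single)

lemma subst_mult: "subst \<phi> (p * q) = subst \<phi> p * subst \<phi> q"
proof (induction p rule: terms_induct)
  case (single a c)
  show ?case
  proof (induction q rule: terms_induct)
    case (single b d)
    show ?case
      by (simp add: subst_single mult_single[of a c b d] power_prod_add const_mult mult_ac)
  qed (simp_all add: distrib_left subst_add)
qed (simp_all add: distrib_right subst_add)

lemma subst_1 [simp]: "subst (\<phi> :: 'u \<Rightarrow> ('v, 'b::comm_ring_1) mpol) 1 = 1"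
  using subst_const[of \<phi> "1::'b"] by simp

lemma subst_diff: "subst \<phi> (p - q) = subst \<phi> p - subst \<phi> q"
  using subst_add[of \<phi> "p - q" q] by simp

lemma subst_power: "subst \<phi> (p ^ k) = subst \<phi> p ^ k"
  by (induction k) (simp_all add: subst_mult)

lemma subst_prod: "subst \<phi> (\<Prod>x\<in>X. p x) = (\<Prod>x\<in>X. subst \<phi> (p x))"
  by (induction X rule: infinite_finite_induct) (simp_all add: subst_mult)

lemma subst_power_prod: "subst \<phi> (power_prod \<psi> a) = power_prod (\<lambda>i. subst \<phi> (\<psi> i)) a"
  by (simp add: power_prod_def subst_prod subst_power)

lemma subst_subst: "subst \<phi> (subst \<psi> p) = subst (\<lambda>i. subst \<phi> (\<psi> i)) p"
  by (induction p rule: terms_induct)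
    (simp_all add: subst_add subst_single subst_mult subst_power_prod)

lemma power_prod_Var: "power_prod Var a = Poly_Mapping.single a (1 :: 'a::comm_ring_1)"
proof (induction a rule: terms_induct)
  case (single i k)
  have "Var i ^ k = Poly_Mapping.single (Poly_Mapping.single i k) (1 :: 'a)"
    by (induction k) (simp_all add: Var_def mult_single single_add[symmetric])
  then show ?case by (simp add: power_prod_single)
qed (simp_all add: power_prod_add mult_single)

lemma subst_Var_id [simp]: "subst Var p = p"
  by (induction p rule: terms_induct)
    (simp_all add: subst_add subst_single power_prod_Var mult_single)

lemma poly_ring_terms_induct [consumes 1, case_names zero single add]:
  fixes p :: "('v, 'a::comm_monoid_add) mpol"
  assumes "p \<in> poly_ring V"
    and "P 0"
    and "\<And>a c. Poly_Mapping.keys a \<subseteq> V \<Longrightarrow> P (Poly_Mapping.single a c)"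
    and "\<And>p q. P p \<Longrightarrow> P q \<Longrightarrow> P (p + q)"
  shows "P p"
  by (rule poly_mapping_terms_induct[of p "{a. Poly_Mapping.keys a \<subseteq> V}"])
    (use assms in \<open>auto simp: poly_ring_def\<close>)

lemma subst_cong:
  assumes "p \<in> poly_ring V" "\<And>i. i \<in> V \<Longrightarrow> \<phi> i = \<psi> i"
  shows "subst \<phi> p = subst \<psi> p"
  using assms(1)
proof (induction p rule: poly_ring_terms_induct)
  case (single a c)
  then have "power_prod \<phi> a = power_prod \<psi> a"
    using assms(2) by (intro power_prod_cong) auto
  then show ?case by (simp add: subst_single)
qed (simp_all add: subst_add)

lemma subst_ident:
  assumes "p \<in> poly_ring V" "\<And>i. i \<in> V \<Longrightarrow> \<phi> i = Var i"
  shows "subst \<phi> p = p"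
  using subst_cong[OF assms] by simp

lemma poly_ring_single: "Poly_Mapping.keys a \<subseteq> V \<Longrightarrow> Poly_Mapping.single a c \<in> poly_ring V"
  by (auto simp: poly_ring_def)

lemma poly_ring_const [simp]: "const c \<in> poly_ring V"
  by (simp add: poly_ring_single)

lemma poly_ring_0 [simp]: "0 \<in> poly_ring V"
  by (simp add: poly_ring_def)

lemma poly_ring_1 [simp]: "(1 :: ('v, 'a::comm_ring_1) mpol) \<in> poly_ring V"
  using poly_ring_const[of "1::'a" V] by simp

lemma poly_ring_Var: "i \<in> V \<Longrightarrow> Var i \<in> poly_ring V"
  by (simp add: Var_def poly_ring_single)

lemma poly_ring_add: "p \<in> poly_ring V \<Longrightarrow> q \<in> poly_ring V \<Longrightarrow> p + q \<in> poly_ring V"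
  using Poly_Mapping.keys_add[of p q] by (auto simp: poly_ring_def)

lemma poly_ring_diff:
  fixes p q :: "('v, 'a::comm_ring_1) mpol"
  shows "p \<in> poly_ring V \<Longrightarrow> q \<in> poly_ring V \<Longrightarrow> p - q \<in> poly_ring V"
  using Poly_Mapping.keys_diff[of p q] by (auto simp: poly_ring_def)

lemma poly_ring_mult:
  fixes p q :: "('v, 'a::comm_ring_1) mpol"
  shows "p \<in> poly_ring V \<Longrightarrow> q \<in> poly_ring V \<Longrightarrow> p * q \<in> poly_ring V"
  unfolding poly_ring_def
proof clarify
  fix a i assume p: "\<forall>a\<in>Poly_Mapping.keys p. Poly_Mapping.keys a \<subseteq> V"
    and q: "\<forall>a\<in>Poly_Mapping.keys q. Poly_Mapping.keys a \<subseteq> V"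
    and "a \<in> Poly_Mapping.keys (p * q)" and i: "i \<in> Poly_Mapping.keys a"
  then obtain b c where "a = b + c" "b \<in> Poly_Mapping.keys p" "c \<in> Poly_Mapping.keys q"
    using Poly_Mapping.keys_mult[of p q] by blast
  then show "i \<in> V"
    using p q i by (auto simp: keys_plus_nat)
qed

lemma poly_ring_mono: "V \<subseteq> W \<Longrightarrow> poly_ring V \<subseteq> poly_ring W"
  by (auto simp: poly_ring_def)

text \<open>Substitutions are the homomorphisms out of a polynomial ring, so a subalgebra contains an
  image as soon as it contains the images of the variables.\<close>

lemma subst_in_subalg_closed:
  assumes "p \<in> poly_ring V" "\<And>i. i \<in> V \<Longrightarrow> \<phi> i \<in> R"
    and "\<And>c. const c \<in> R" "\<And>p q. p \<in> R \<Longrightarrow> q \<in> R \<Longrightarrow> p + q \<in> R"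
      "\<And>p q. p \<in> R \<Longrightarrow> q \<in> R \<Longrightarrow> p * q \<in> R"
  shows "subst \<phi> p \<in> R"
  using assms(1)
proof (induction p rule: poly_ring_terms_induct)
  case zero
  show ?case using assms(3)[of 0] by simp
next
  case (single a c)
  have one: "1 \<in> R" using assms(3)[of 1] by simp
  have pow: "\<phi> i ^ k \<in> R" if "i \<in> V" for i k
    using that by (induction k) (simp_all add: one assms(2,5) that)
  have "(\<Prod>i\<in>F. \<phi> i ^ Poly_Mapping.lookup a i) \<in> R" if "finite F" "F \<subseteq> V" for F
    using that by (induction F rule: finite_induct) (auto intro: one pow assms(5))
  from this[OF finite_keys single] show ?case
    by (simp add: subst_single power_prod_def assms(3,5))
qed (simp_all add: subst_add assms(4))

lemma subst_in_poly_ring: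
  "p \<in> poly_ring V \<Longrightarrow> (\<And>i. i \<in> V \<Longrightarrow> \<phi> i \<in> poly_ring W) \<Longrightarrow> subst \<phi> p \<in> poly_ring W"
  by (rule subst_in_subalg_closed) (auto intro: poly_ring_add poly_ring_mult)

lemma subst_in_subalg:
  "p \<in> poly_ring V \<Longrightarrow> (\<And>i. i \<in> V \<Longrightarrow> \<phi> i \<in> subalg S) \<Longrightarrow> subst \<phi> p \<in> subalg S"
  by (rule subst_in_subalg_closed) (auto intro: subalg.intros)

lemma subalg_image_subst:
  assumes "p \<in> subalg (f ` V)"
  shows "\<exists>q\<in>poly_ring V. subst f q = p"
  using assms
proof (induction rule: subalg.induct)
  case (const c)
  show ?case using poly_ring_const subst_const by blast
next
  case (gen s)
  then obtain i where "i \<in> V" "s = f i" by blast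
  then have "Var i \<in> poly_ring V" "subst f (Var i) = s"
    by (simp_all add: poly_ring_Var)
  then show ?case by blast
next
  case (add p q)
  then show ?case using poly_ring_add subst_add by metis
next
  case (mult p q)
  then show ?case using poly_ring_mult subst_mult by metis
qed

section \<open>Weights and homogeneous parts\<close>

text \<open>A name for the inner sum of \<^const>\<open>wdot\<close>, so that the laws of multiples apply to it.\<close>

definition nmul :: "nat \<Rightarrow> 'g::ab_group_add \<Rightarrow> 'g" where
  "nmul k x = (\<Sum>_<k. x)"

lemma nmul_0 [simp]: "nmul 0 x = 0"
  and nmul_Suc [simp]: "nmul (Suc k) x = x + nmul k x"
  by (simp_all add: nmul_def add.commute)

lemma nmul_zero [simp]: "nmul k 0 = 0"
  by (simp add: nmul_def)

lemma nmul_add_left: "nmul (j + k) x = nmul j x + nmul k x"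
  by (induction j) (simp_all add: add.assoc)

lemma nmul_add: "nmul k (x + y) = nmul k x + nmul k y"
  by (induction k) (simp_all add: ac_simps)

lemma nmul_diff: "nmul k (x - y) = nmul k x - nmul k y"
  by (induction k) (simp_all add: algebra_simps)

lemma nmul_sum: "nmul k (\<Sum>i\<in>I. x i) = (\<Sum>i\<in>I. nmul k (x i))"
  by (induction I rule: infinite_finite_induct) (simp_all add: nmul_add)

lemma nmul_nmul: "nmul j (nmul k x) = nmul (j * k) x"
  by (induction j) (simp_all add: nmul_add_left)

lemma nmul_commute: "nmul j (nmul k x) = nmul k (nmul j x)"
  by (simp add: nmul_nmul mult.commute)

lemma nmul_int: "nmul k (x :: int) = int k * x"
  by (simp add: nmul_def)

lemma nmul_mono: "x \<le> y \<Longrightarrow> nmul k x \<le> nmul k (y :: 'g::linordered_ab_group_add)"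
  by (induction k) (simp_all add: add_mono)

lemma nmul_strict_mono: "x < y \<Longrightarrow> 0 < k \<Longrightarrow> nmul k x < nmul k (y :: 'g::linordered_ab_group_add)"
  by (cases k) (simp_all add: add_less_le_mono nmul_mono less_imp_le)

text \<open>An ordered group is torsion free, and multiples may be cancelled from inequalities.\<close>

lemma nmul_le_iff: "0 < k \<Longrightarrow> nmul k x \<le> nmul k y \<longleftrightarrow> x \<le> (y :: 'g::linordered_ab_group_add)"
  using nmul_mono nmul_strict_mono by (metis linorder_not_le)

lemma nmul_eq_iff: "0 < k \<Longrightarrow> nmul k x = nmul k y \<longleftrightarrow> x = (y :: 'g::linordered_ab_group_add)"
  by (metis nmul_le_iff order_antisym order_refl)

lemma wdot_superset:
  assumes "finite F" "Poly_Mapping.keys a \<subseteq> F"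
  shows "wdot a w = (\<Sum>i\<in>F. nmul (Poly_Mapping.lookup a i) (w i))"
  unfolding wdot_def nmul_def
  by (rule sum.mono_neutral_left) (use assms in \<open>auto simp: in_keys_iff\<close>)

lemma wdot_keys: "wdot a w = (\<Sum>i\<in>Poly_Mapping.keys a. nmul (Poly_Mapping.lookup a i) (w i))"
  by (simp add: wdot_superset)

lemma wdot_add: "wdot (a + b) w = wdot a w + wdot b w"
proof -
  let ?F = "Poly_Mapping.keys a \<union> Poly_Mapping.keys b"
  show ?thesis
    by (simp add: wdot_superset[of ?F] keys_plus_nat lookup_add nmul_add_left sum.distrib)
qed

lemma wdot_0 [simp]: "wdot 0 w = 0"
  by (simp add: wdot_def)

lemma wdot_single: "wdot (Poly_Mapping.single i k) w = nmul k (w i)"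
  by (simp add: wdot_superset[of "{i}"])

lemma wdot_cong: "(\<And>i. i \<in> Poly_Mapping.keys a \<Longrightarrow> w i = w' i) \<Longrightarrow> wdot a w = wdot a w'"
  by (simp add: wdot_keys)

lemma wdot_nmul: "wdot a (\<lambda>i. nmul k (w i)) = nmul k (wdot a w)"
  by (simp add: wdot_keys nmul_sum nmul_commute)

lemma wdot_indicator:
  "wdot a (\<lambda>j. if j = i then x else 0) = nmul (Poly_Mapping.lookup a i) x"
proof -
  have "wdot a (\<lambda>j. if j = i then x else 0) =
    (\<Sum>j\<in>insert i (Poly_Mapping.keys a). if j = i then nmul (Poly_Mapping.lookup a i) x else 0)"
    by (simp only: wdot_superset[of "insert i (Poly_Mapping.keys a)"] finite_insert finite_keys
        subset_insertI) (rule sum.cong, auto)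
  then show ?thesis by simp
qed

text \<open>The weight function for which the degree of a polynomial is its degree in the variable
  \<open>t\<close>; the part of degree 0 is then the value at \<open>t = 0\<close>.\<close>

definition deg_in :: "'v \<Rightarrow> 'v \<Rightarrow> int" where
  "deg_in t = (\<lambda>i. if i = t then 1 else 0)"

lemma wdot_deg_in: "wdot a (deg_in t) = int (Poly_Mapping.lookup a t)"
  by (simp add: deg_in_def wdot_indicator nmul_int)

lemma wdot_weight_add: "wdot a (\<lambda>i. w i + w' i) = wdot a w + wdot a w'"
  by (simp add: wdot_keys nmul_add sum.distrib)

definition weight_le :: "('v \<Rightarrow> 'g::linordered_ab_group_add) \<Rightarrow> 'g \<Rightarrow> ('v, 'a::zero) mpol \<Rightarrow> bool" where
  "weight_le w d p \<longleftrightarrow> (\<forall>a\<in>Poly_Mapping.keys p. wdot a w \<le> d)"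

definition hom_part ::
    "('v \<Rightarrow> 'g::linordered_ab_group_add) \<Rightarrow> 'g \<Rightarrow> ('v, 'a::comm_ring_1) mpol \<Rightarrow> ('v, 'a) mpol" where
  "hom_part w d p = (\<Sum>a \<in> {a \<in> Poly_Mapping.keys p. wdot a w = d}.
     Poly_Mapping.single a (Poly_Mapping.lookup p a))"

lemma initial_form_hom_part: "initial_form w p = hom_part w (wdeg w p) p"
  by (simp add: initial_form_def hom_part_def)

lemma lookup_hom_part:
  "Poly_Mapping.lookup (hom_part w d p) a = (if wdot a w = d then Poly_Mapping.lookup p a else 0)"
  by (simp add: hom_part_def lookup_sum lookup_single when_def in_keys_iff
      sum.delta[of "{a \<in> Poly_Mapping.keys p. wdot a w = d}"])

lemma keys_hom_part: "Poly_Mapping.keys (hom_part w d p) = {a \<in> Poly_Mapping.keys p. wdot a w = d}"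
  by (auto simp: in_keys_iff lookup_hom_part split: if_splits)

lemma hom_part_0 [simp]: "hom_part w d 0 = 0"
  by (simp add: hom_part_def)

lemma hom_part_add: "hom_part w d (p + q) = hom_part w d p + hom_part w d q"
  by (rule poly_mapping_eqI) (simp add: lookup_hom_part lookup_add)

lemma hom_part_single:
  "hom_part w d (Poly_Mapping.single a c) = (if wdot a w = d then Poly_Mapping.single a c else 0)"
  by (rule poly_mapping_eqI) (auto simp add: lookup_hom_part lookup_single when_def)

lemma hom_part_poly_ring: "p \<in> poly_ring V \<Longrightarrow> hom_part w d p \<in> poly_ring V"
  by (simp add: poly_ring_def keys_hom_part)

lemma hom_part_lower:
  assumes "weight_le w e p" "e < d"
  shows "hom_part w d p = 0"
proof -
  have "{a \<in> Poly_Mapping.keys p. wdot a w = d} = {}"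
    using assms by (auto simp: weight_le_def)
  then show ?thesis by (simp only: hom_part_def sum.empty)
qed

lemma weight_le_mono: "weight_le w d p \<Longrightarrow> d \<le> e \<Longrightarrow> weight_le w e p"
  by (meson order_trans weight_le_def)

lemma weight_le_0 [simp]: "weight_le w d 0"
  by (simp add: weight_le_def)

lemma weight_le_add: "weight_le w d p \<Longrightarrow> weight_le w d q \<Longrightarrow> weight_le w d (p + q)"
  using Poly_Mapping.keys_add[of p q] by (auto simp: weight_le_def)

lemma weight_le_const: "weight_le w 0 (const c)"
  by (simp add: weight_le_def)

lemma weight_le_mult:
  fixes p q :: "('v, 'a::comm_ring_1) mpol"
  shows "weight_le w d p \<Longrightarrow> weight_le w e q \<Longrightarrow> weight_le w (d + e) (p * q)"
  unfolding weight_le_def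
proof
  fix a assume p: "\<forall>a\<in>Poly_Mapping.keys p. wdot a w \<le> d"
    and q: "\<forall>a\<in>Poly_Mapping.keys q. wdot a w \<le> e"
    and "a \<in> Poly_Mapping.keys (p * q)"
  then obtain b c where "a = b + c" "b \<in> Poly_Mapping.keys p" "c \<in> Poly_Mapping.keys q"
    using Poly_Mapping.keys_mult[of p q] by blast
  then show "wdot a w \<le> d + e"
    using p q by (simp add: wdot_add add_mono)
qed

lemma weight_le_terms_induct [consumes 1, case_names zero single add]:
  fixes p :: "('v, 'a::comm_monoid_add) mpol"
  assumes "weight_le w d p"
    and "P 0"
    and "\<And>a c. wdot a w \<le> d \<Longrightarrow> P (Poly_Mapping.single a c)"
    and "\<And>p q. P p \<Longrightarrow> P q \<Longrightarrow> P (p + q)"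
  shows "P p"
  by (rule poly_mapping_terms_induct[of p "{a. wdot a w \<le> d}"])
    (use assms in \<open>auto simp: weight_le_def\<close>)

text \<open>Parts of top possible weight multiply: two terms reach the weight \<open>d + e\<close> only if they
  reach \<open>d\<close> and \<open>e\<close> separately. The bounds may be larger than the actual degrees, in which
  case both sides vanish.\<close>

lemma hom_part_mult:
  fixes p q :: "('v, 'a::comm_ring_1) mpol"
  assumes "weight_le w d p" "weight_le w e q"
  shows "hom_part w (d + e) (p * q) = hom_part w d p * hom_part w e q"
  using assms(1)
proof (induction p rule: weight_le_terms_induct)
  case (single a x)
  note a = this
  from assms(2) show ?case
  proof (induction q rule: weight_le_terms_induct)
    case (single b y)
    have "wdot a w + wdot b w = d + e \<longleftrightarrow> wdot a w = d \<and> wdot b w = e"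
      using a single by (metis add_le_less_mono add_less_le_mono order_le_less order_less_irrefl)
    then show ?case by (simp add: mult_single hom_part_single wdot_add)
  qed (simp_all add: distrib_left hom_part_add)
qed (simp_all add: distrib_right hom_part_add)

lemma weight_le_1: "weight_le w 0 (1 :: ('v, 'a::comm_ring_1) mpol)"
  using weight_le_const[of w "1::'a"] by simp

lemma hom_part_1: "hom_part w 0 (1 :: ('v, 'a::comm_ring_1) mpol) = 1"
  using hom_part_single[of w 0 0 "1::'a"] by simp

lemma weight_le_power:
  fixes p :: "('v, 'a::comm_ring_1) mpol"
  shows "weight_le w d p \<Longrightarrow> weight_le w (nmul k d) (p ^ k)"
  by (induction k) (simp_all add: weight_le_1 weight_le_mult)

lemma hom_part_power: "weight_le w d p \<Longrightarrow> hom_part w (nmul k d) (p ^ k) = hom_part w d p ^ k"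
  by (induction k) (simp_all add: hom_part_1 hom_part_mult weight_le_power)

lemma weight_le_prod:
  fixes p :: "'x \<Rightarrow> ('v, 'a::comm_ring_1) mpol"
  shows
  "(\<And>x. x \<in> X \<Longrightarrow> weight_le w (d x) (p x)) \<Longrightarrow> weight_le w (\<Sum>x\<in>X. d x) (\<Prod>x\<in>X. p x)"
  by (induction X rule: infinite_finite_induct) (simp_all add: weight_le_1 weight_le_mult)

lemma hom_part_prod:
  "(\<And>x. x \<in> X \<Longrightarrow> weight_le w (d x) (p x)) \<Longrightarrow>
     hom_part w (\<Sum>x\<in>X. d x) (\<Prod>x\<in>X. p x) = (\<Prod>x\<in>X. hom_part w (d x) (p x))"
  by (induction X rule: infinite_finite_induct)
    (simp_all add: hom_part_1 hom_part_mult weight_le_prod)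

lemma weight_le_power_prod:
  assumes "\<And>i. i \<in> Poly_Mapping.keys a \<Longrightarrow> weight_le w (v i) (\<phi> i)"
  shows "weight_le w (wdot a v) (power_prod \<phi> a)"
  unfolding power_prod_def wdot_keys by (intro weight_le_prod weight_le_power assms)

lemma hom_part_power_prod:
  assumes "\<And>i. i \<in> Poly_Mapping.keys a \<Longrightarrow> weight_le w (v i) (\<phi> i)"
  shows "hom_part w (wdot a v) (power_prod \<phi> a) = power_prod (\<lambda>i. hom_part w (v i) (\<phi> i)) a"
  unfolding power_prod_def wdot_keys
  by (simp add: hom_part_prod weight_le_power hom_part_power assms)

lemma lookup_const_mult:
  "Poly_Mapping.lookup (const c * p) a = c * Poly_Mapping.lookup p a"
    for p :: "('v, 'a::comm_ring_1) mpol"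
  by (induction p rule: terms_induct)
    (simp_all add: distrib_left lookup_add mult_single lookup_single when_def)

lemma hom_part_const_mult:
  fixes p :: "('v, 'a::comm_ring_1) mpol"
  shows "hom_part w d (const c * p) = const c * hom_part w d p"
  by (induction p rule: terms_induct)
    (simp_all add: distrib_left hom_part_add mult_single hom_part_single)

lemma weight_le_const_mult:
  fixes p :: "('v, 'a::comm_ring_1) mpol"
  shows "weight_le w d p \<Longrightarrow> weight_le w d (const c * p)"
  using weight_le_mult[OF weight_le_const, of w d p c] by simp

text \<open>The tool for passing to leading terms: when the image of each variable is bounded by the
  weight of that variable, the substitution respects the filtrations by weight, and the homomorphism
  induced on the graded rings is the substitution of the parts of exact weight.\<close>

lemma weight_le_subst:
  assumes "p \<in> poly_ring V" "\<And>i. i \<in> V \<Longrightarrow> weight_le w (v i) (\<phi> i)" "weight_le v d p"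
  shows "weight_le w d (subst \<phi> p)"
    and "hom_part w d (subst \<phi> p) = subst (\<lambda>i. hom_part w (v i) (\<phi> i)) (hom_part v d p)"
proof -
  let ?K = "{a. Poly_Mapping.keys a \<subseteq> V \<and> wdot a v \<le> d}"
  have "Poly_Mapping.keys p \<subseteq> ?K"
    using assms(1,3) by (auto simp: poly_ring_def weight_le_def)
  then have "weight_le w d (subst \<phi> p) \<and>
    hom_part w d (subst \<phi> p) = subst (\<lambda>i. hom_part w (v i) (\<phi> i)) (hom_part v d p)"
  proof (induction p rule: poly_mapping_terms_induct)
    case (single a c)
    then have phi: "weight_le w (v i) (\<phi> i)" if "i \<in> Poly_Mapping.keys a" for i
      using assms(2) that by auto
    have le: "weight_le w (wdot a v) (power_prod \<phi> a)"
      using phi by (rule weight_le_power_prod)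
    show ?case
    proof (cases "wdot a v = d")
      case True
      then show ?thesis
        using le hom_part_power_prod[of a w v \<phi>] phi
        by (simp add: subst_single weight_le_const_mult hom_part_const_mult hom_part_single)
    next
      case False
      then have "wdot a v < d" using single by auto
      then show ?thesis
        using le hom_part_lower[OF le]
        by (simp add: subst_single weight_le_const_mult hom_part_const_mult hom_part_single
            weight_le_mono[OF le] False)
    qed
  qed (simp_all add: subst_add hom_part_add weight_le_add)
  then show "weight_le w d (subst \<phi> p)"
    and "hom_part w d (subst \<phi> p) = subst (\<lambda>i. hom_part w (v i) (\<phi> i)) (hom_part v d p)"
    by auto
qed

lemma weight_le_wdeg: "weight_le w (wdeg w p) p"
  by (simp add: weight_le_def wdeg_def)

lemma wdeg_attained:
  assumes "p \<noteq> 0"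
  obtains a where "a \<in> Poly_Mapping.keys p" "wdot a w = wdeg w p"
proof -
  have "wdeg w p \<in> (\<lambda>a. wdot a w) ` Poly_Mapping.keys p"
    unfolding wdeg_def using assms by (intro Max_in) auto
  then show ?thesis using that by auto
qed

lemma hom_part_wdeg_nonzero: "p \<noteq> 0 \<Longrightarrow> hom_part w (wdeg w p) p \<noteq> 0"
  using wdeg_attained[of p w] keys_hom_part[of w "wdeg w p" p] keys_zero
  by (metis (mono_tags, lifting) empty_iff mem_Collect_eq)

lemma weight_le_deg_in_0: "weight_le (deg_in t) 0 p \<longleftrightarrow> p \<in> poly_ring (- {t})"
  by (auto simp: weight_le_def wdot_deg_in poly_ring_def in_keys_iff)

lemma hom_part_deg_in_0:
  assumes "p \<in> poly_ring V" "t \<notin> V"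
  shows "hom_part (deg_in t) 0 p = p"
proof (rule poly_mapping_eqI)
  fix a
  have "Poly_Mapping.lookup a t = 0" if "a \<in> Poly_Mapping.keys p"
    using assms that not_in_keys_iff_lookup_eq_zero[of t a] by (auto simp: poly_ring_def)
  then show "Poly_Mapping.lookup (hom_part (deg_in t) 0 p) a = Poly_Mapping.lookup p a"
    by (cases "a \<in> Poly_Mapping.keys p") (simp_all add: lookup_hom_part wdot_deg_in in_keys_iff)
qed

lemma subst_zero_hom_part:
  fixes p :: "('v, 'a::comm_ring_1) mpol"
  shows "subst (Var(t := 0)) p = hom_part (deg_in t) 0 p"
proof (induction p rule: terms_induct)
  case (single a c)
  have eq: "power_prod (Var(t := 0)) a = hom_part (deg_in t) 0 (Poly_Mapping.single a (1 :: 'a))"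
  proof (cases "Poly_Mapping.lookup a t = 0")
    case True
    then have "power_prod (Var(t := 0)) a = power_prod Var a"
      by (intro power_prod_cong) (auto simp: in_keys_iff)
    then show ?thesis using True by (simp add: power_prod_Var hom_part_single wdot_deg_in)
  next
    case False
    then have "power_prod (Var(t := 0)) a = 0"
      unfolding power_prod_def by (intro prod_zero bexI[of _ t]) (auto simp: in_keys_iff zero_power)
    then show ?thesis using False by (simp add: hom_part_single wdot_deg_in)
  qed
  show ?case
    unfolding subst_single eq by (simp add: hom_part_const_mult[symmetric] mult_single)
qed (simp_all add: subst_add hom_part_add)

lemma hom_part_commute: "hom_part v d (hom_part w e p) = hom_part w e (hom_part v d p)"
  by (rule poly_mapping_eqI) (simp add: lookup_hom_part)

section \<open>Algebraic dependence by counting monomials\<close>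

text \<open>Gaussian elimination without division: one equation with a nonzero coefficient \<open>A e i0\<close>
  removes the unknown \<open>i0\<close> after the others are multiplied by that pivot. Over a domain the
  pivot does not kill a nontrivial solution.\<close>

lemma homogeneous_system_nontrivial_solution:
  fixes A :: "'e \<Rightarrow> 'i \<Rightarrow> 'k::idom"
  assumes "finite E" "finite I" "card E < card I"
  shows "\<exists>c. (\<exists>i\<in>I. c i \<noteq> 0) \<and> (\<forall>e\<in>E. (\<Sum>i\<in>I. c i * A e i) = 0)"
  using assms
proof (induction E arbitrary: I A rule: finite_induct)
  case empty
  then have "I \<noteq> {}" by auto
  then show ?case by (intro exI[of _ "\<lambda>_. 1"]) auto
next
  case (insert e E)
  show ?case
  proof (cases "\<forall>i\<in>I. A e i = 0")
    case True
    obtain c where "\<exists>i\<in>I. c i \<noteq> 0" "\<forall>e\<in>E. (\<Sum>i\<in>I. c i * A e i) = 0"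
      using insert.IH[of I A] insert.prems insert.hyps by auto
    then show ?thesis using True by (intro exI[of _ c]) auto
  next
    case False
    then obtain i0 where i0: "i0 \<in> I" "A e i0 \<noteq> 0" by auto
    let ?J = "I - {i0}"
    have "card E < card ?J"
      using insert.prems insert.hyps i0 by simp
    then obtain c where c: "\<exists>i\<in>?J. c i \<noteq> 0"
      "\<forall>e'\<in>E. (\<Sum>i\<in>?J. c i * (A e i0 * A e' i - A e' i0 * A e i)) = 0"
      using insert.IH[of ?J "\<lambda>e' i. A e i0 * A e' i - A e' i0 * A e i"] insert.prems
      by blast
    \<comment> \<open>Equation \<open>e\<close> determines the value at \<open>i0\<close> once the other unknowns are scaled by the pivot.\<close>
    define c' where "c' = (\<lambda>i. if i = i0 then - (\<Sum>i\<in>?J. c i * A e i) else A e i0 * c i)"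
    have sum: "(\<Sum>i\<in>I. c' i * A e' i) =
        (\<Sum>i\<in>?J. c i * (A e i0 * A e' i - A e' i0 * A e i))" for e'
    proof -
      have "(\<Sum>i\<in>I. c' i * A e' i) = c' i0 * A e' i0 + (\<Sum>i\<in>?J. c' i * A e' i)"
        using i0 insert.prems by (simp add: sum.remove)
      also have "(\<Sum>i\<in>?J. c' i * A e' i) = (\<Sum>i\<in>?J. A e i0 * c i * A e' i)"
        by (rule sum.cong) (auto simp: c'_def)
      also have "c' i0 * A e' i0 = (\<Sum>i\<in>?J. - (c i * A e i * A e' i0))"
        by (simp add: c'_def sum_distrib_right sum_negf)
      finally show ?thesis
        by (simp add: sum.distrib[symmetric] algebra_simps)
    qed
    have "\<exists>i\<in>I. c' i \<noteq> 0"
      using c(1) i0 by (auto simp: c'_def)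
    moreover have "(\<Sum>i\<in>I. c' i * A e' i) = 0" if "e' \<in> insert e E" for e'
      using that c(2) by (auto simp: sum mult.commute)
    ultimately show ?thesis by blast
  qed
qed

lemma polys_dependent_modulo:
  fixes v :: "'i \<Rightarrow> ('v, 'k::idom) mpol"
  assumes "finite E" "finite I" "card E < card I"
  shows "\<exists>c. (\<exists>i\<in>I. c i \<noteq> 0) \<and>
    (\<forall>e\<in>E. Poly_Mapping.lookup (\<Sum>i\<in>I. const (c i) * v i) e = 0)"
  using homogeneous_system_nontrivial_solution[OF assms, of "\<lambda>e i. Poly_Mapping.lookup (v i) e"]
  by (simp add: lookup_sum lookup_const_mult)

definition box :: "'v set \<Rightarrow> nat \<Rightarrow> ('v \<Rightarrow>\<^sub>0 nat) set" where
  "box V N = {a. Poly_Mapping.keys a \<subseteq> V \<and> (\<forall>i. Poly_Mapping.lookup a i \<le> N)}"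

lemma box_bij:
  assumes "finite V"
  shows "bij_betw (\<lambda>a. restrict (Poly_Mapping.lookup a) V) (box V N) (V \<rightarrow>\<^sub>E {..N})"
proof (rule bij_betw_byWitness[where f' = "\<lambda>g. Abs_poly_mapping (\<lambda>i. if i \<in> V then g i else 0)"])
  have look: "Poly_Mapping.lookup (Abs_poly_mapping (\<lambda>i. if i \<in> V then g i else 0)) =
      (\<lambda>i. if i \<in> V then g i else 0)" for g :: "'a \<Rightarrow> nat"
    using assms by (intro lookup_Abs_poly_mapping) (auto intro: finite_subset)
  show "\<forall>a\<in>box V N. Abs_poly_mapping (\<lambda>i. if i \<in> V then restrict (Poly_Mapping.lookup a) V i else 0) = a"
  proof
    fix a assume "a \<in> box V N"
    then show "Abs_poly_mapping (\<lambda>i. if i \<in> V then restrict (Poly_Mapping.lookup a) V i else 0) = a"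
      by (intro poly_mapping_eqI) (auto simp: look box_def in_keys_iff)
  qed
  show "\<forall>g\<in>V \<rightarrow>\<^sub>E {..N}. restrict (Poly_Mapping.lookup
      (Abs_poly_mapping (\<lambda>i. if i \<in> V then g i else 0))) V = g"
    by (auto simp: look PiE_def extensional_def fun_eq_iff restrict_def)
  show "(\<lambda>a. restrict (Poly_Mapping.lookup a) V) ` box V N \<subseteq> V \<rightarrow>\<^sub>E {..N}"
    by (auto simp: box_def)
  show "(\<lambda>g. Abs_poly_mapping (\<lambda>i. if i \<in> V then g i else 0)) ` (V \<rightarrow>\<^sub>E {..N}) \<subseteq> box V N"
    by (auto simp: box_def look in_keys_iff split: if_splits)
qed

lemma finite_box: "finite V \<Longrightarrow> finite (box V N)"
  using bij_betw_finite[OF box_bij[of V N]] by (simp add: finite_PiE)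

lemma card_box: "finite V \<Longrightarrow> card (box V N) = (N + 1) ^ card V"
  using bij_betw_same_card[OF box_bij[of V N]] by (simp add: card_PiE)

lemma bounded_exponents:
  assumes "finite U"
  obtains D where "\<And>u a i. u \<in> U \<Longrightarrow> a \<in> Poly_Mapping.keys (h u) \<Longrightarrow> Poly_Mapping.lookup a i \<le> (D :: nat)"
proof -
  have "finite (\<Union>u\<in>U. \<Union>a\<in>Poly_Mapping.keys (h u). Poly_Mapping.lookup a ` Poly_Mapping.keys a)"
    using assms by simp
  then obtain D where D: "\<forall>k \<in> (\<Union>u\<in>U. \<Union>a\<in>Poly_Mapping.keys (h u).
      Poly_Mapping.lookup a ` Poly_Mapping.keys a). k \<le> D"
    unfolding finite_nat_set_iff_bounded_le by blast
  have "Poly_Mapping.lookup a i \<le> D" if "u \<in> U" "a \<in> Poly_Mapping.keys (h u)" for u a i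
    using D that by (cases "i \<in> Poly_Mapping.keys a") (auto simp: in_keys_iff)
  then show ?thesis using that by blast
qed

text \<open>A count of monomials. Products of the \<open>h u\<close> with all exponents at most \<open>N\<close> number
  \<open>(N + 1) ^ card U\<close>, and they lie in the span of \<open>(M + 1) ^ card V\<close> monomials, where \<open>M\<close> is linear
  in \<open>N\<close>. As \<open>card V < card U\<close>, the first number wins for large \<open>N\<close>, and these products are
  linearly dependent.\<close>

lemma more_polys_than_variables_dependent:
  fixes h :: "'u \<Rightarrow> ('v, 'k::idom) mpol"
  assumes "finite U" "finite V" "card V < card U"
    and h: "\<And>u. u \<in> U \<Longrightarrow> h u \<in> poly_ring V"
  shows "\<exists>P\<in>poly_ring U. P \<noteq> 0 \<and> subst h P = 0"
proof -
  obtain D where D: "\<And>u a i. u \<in> U \<Longrightarrow> a \<in> Poly_Mapping.keys (h u) \<Longrightarrow> Poly_Mapping.lookup a i \<le> D"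
    by (rule bounded_exponents[OF assms(1), of h]) blast
  \<comment> \<open>\<open>M\<close> bounds the exponents in the products, \<open>M + 1 \<le> C * (N + 1)\<close>, and \<open>N + 1\<close> exceeds
    \<open>C ^ card V\<close>.\<close>
  define C where "C = card U * D + 1"
  define N where "N = C ^ card V"
  define M where "M = card U * N * D"
  have "card (box V M) < card (box U N)"
  proof -
    have "M + 1 \<le> C * (N + 1)" by (simp add: M_def C_def algebra_simps)
    then have "(M + 1) ^ card V \<le> N * (N + 1) ^ card V"
      by (metis N_def power_mono power_mult_distrib zero_le)
    also have "\<dots> < (N + 1) ^ Suc (card V)" by simp
    also have "\<dots> \<le> (N + 1) ^ card U"
      using assms(3) by (intro power_increasing) auto
    finally show ?thesis using assms by (simp add: card_box)
  qed
  then obtain c where c: "\<exists>a\<in>box U N. c a \<noteq> 0"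
    "\<And>e. e \<in> box V M \<Longrightarrow>
        Poly_Mapping.lookup (\<Sum>a\<in>box U N. const (c a) * power_prod h a) e = 0"
    using polys_dependent_modulo[OF finite_box[OF assms(2)] finite_box[OF assms(1)], of _ _ "power_prod h"]
    by blast
  have supp: "Poly_Mapping.keys (power_prod h a) \<subseteq> box V M" if a: "a \<in> box U N" for a
  proof
    fix b assume b: "b \<in> Poly_Mapping.keys (power_prod h a)"
    have aU: "Poly_Mapping.keys a \<subseteq> U" "\<And>i. Poly_Mapping.lookup a i \<le> N"
      using a by (auto simp: box_def)
    have "subst h (Poly_Mapping.single a 1) \<in> poly_ring V"
      using aU h by (intro subst_in_poly_ring[of _ U] poly_ring_single) auto
    then have "Poly_Mapping.keys b \<subseteq> V"
      using b by (auto simp: subst_single poly_ring_def)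
    moreover have "Poly_Mapping.lookup b i \<le> M" for i
    proof -
      have "weight_le (deg_in i) (wdot a (\<lambda>_. int D)) (power_prod h a)"
        using D aU by (intro weight_le_power_prod) (auto simp: weight_le_def wdot_deg_in)
      then have "int (Poly_Mapping.lookup b i) \<le> wdot a (\<lambda>_. int D)"
        using b by (auto simp: weight_le_def wdot_deg_in)
      also have "\<dots> = (\<Sum>j\<in>U. int (Poly_Mapping.lookup a j * D))"
        using aU assms(1) by (simp add: wdot_superset nmul_int)
      also have "\<dots> \<le> (\<Sum>j\<in>U. int (N * D))"
        using aU by (intro sum_mono) (simp only: of_nat_le_iff mult_le_mono1)
      also have "\<dots> = int M" by (simp add: M_def)
      finally show ?thesis by simp
    qed
    ultimately show "b \<in> box V M" by (simp add: box_def)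
  qed
  define P where "P = (\<Sum>a\<in>box U N. Poly_Mapping.single a (c a))"
  have lookP: "Poly_Mapping.lookup P a = (if a \<in> box U N then c a else 0)" for a
    using finite_box[OF assms(1), of N]
    by (simp add: P_def lookup_sum lookup_single when_def sum.delta)
  have "P \<in> poly_ring U"
    by (auto simp: poly_ring_def in_keys_iff[of _ P] lookP box_def split: if_splits)
  moreover have "P \<noteq> 0" using c(1) by (auto simp: poly_mapping_eq_iff fun_eq_iff lookP)
  moreover have "subst h P = 0"
  proof (rule poly_mapping_eqI)
    fix e
    have eq: "subst h P = (\<Sum>a\<in>box U N. const (c a) * power_prod h a)"
      by (simp add: P_def subst_sum subst_single)
    show "Poly_Mapping.lookup (subst h P) e = Poly_Mapping.lookup 0 e"
    proof (cases "e \<in> box V M")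
      case True
      then show ?thesis using c(2) eq by simp
    next
      case False
      then have "Poly_Mapping.lookup (power_prod h a) e = 0" if "a \<in> box U N" for a
        using supp[OF that] by (auto simp: in_keys_iff)
      then show ?thesis by (simp add: eq lookup_sum lookup_const_mult)
    qed
  qed
  ultimately show ?thesis by blast
qed

section \<open>Surjective substitutions are injective\<close>

text \<open>With the weight \<open>-1\<close> on every variable, the polynomials of weight at most \<open>-d\<close> are those
  of order at least \<open>d\<close> at the origin, that is, the \<open>d\<close>-th power of the ideal \<open>\<mm>\<close> generated by the
  variables.\<close>

lemma wdot_minus_one: "wdot a (\<lambda>_. -1 :: int) = - (\<Sum>i\<in>Poly_Mapping.keys a. int (Poly_Mapping.lookup a i))"
  by (simp add: wdot_keys nmul_int sum_negf)

lemma lookup_le_neg_wdot: "int (Poly_Mapping.lookup a i) \<le> - wdot a (\<lambda>_. -1)"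
proof (cases "i \<in> Poly_Mapping.keys a")
  case True
  then show ?thesis
    by (simp add: wdot_minus_one member_le_sum[of i _ "\<lambda>i. int (Poly_Mapping.lookup a i)"])
next
  case False
  then show ?thesis by (simp add: in_keys_iff wdot_minus_one sum_nonneg)
qed

text \<open>If no \<open>f i\<close> has a constant term, substitution of \<open>f\<close> preserves the powers of \<open>\<mm>\<close>, and the
  ring modulo a power of \<open>\<mm>\<close> is free of finite rank with the monomials in \<open>E\<close> as a basis. The
  monomials in the right inverse \<open>Q\<close>, indexed by \<open>E\<close>, together with an element \<open>P\<close> of the
  kernel are one too many, so they are dependent modulo this power. Applying \<open>f\<close> turns the
  dependence into one between the basis monomials, which is trivial; so a nonzero multiple of
  \<open>P\<close> lies in a power of \<open>\<mm>\<close> that was chosen not to contain it.\<close>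

lemma surjective_subst_injective_centred:
  fixes f Q :: "'v \<Rightarrow> ('v, 'k::idom) mpol"
  assumes "finite V"
    and Q: "\<And>i. i \<in> V \<Longrightarrow> Q i \<in> poly_ring V" "\<And>i. i \<in> V \<Longrightarrow> subst f (Q i) = Var i"
    and f0: "\<And>i. i \<in> V \<Longrightarrow> Poly_Mapping.lookup (f i) 0 = 0"
    and P: "P \<in> poly_ring V" "subst f P = 0"
  shows "P = 0"
proof (rule ccontr)
  assume "P \<noteq> 0"
  then obtain b where b: "b \<in> Poly_Mapping.keys P" using keys_eq_empty by blast
  define d where "d = wdot b (\<lambda>_. -1 :: int)"
  \<comment> \<open>\<open>E\<close> spans the complement of the power \<open>- d + 1\<close> of \<open>\<mm>\<close>, and \<open>b\<close> belongs to it.\<close>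
  define E where "E = {a. Poly_Mapping.keys a \<subseteq> V \<and> d \<le> wdot a (\<lambda>_. -1)}"
  have "E \<subseteq> box V (nat (- d))"
  proof
    fix a assume a: "a \<in> E"
    have "int (Poly_Mapping.lookup a i) \<le> - d" for i
      using lookup_le_neg_wdot[of a i] a by (auto simp: E_def)
    then have "Poly_Mapping.lookup a i \<le> nat (- d)" for i
      by (metis nat_int nat_mono)
    then show "a \<in> box V (nat (- d))" using a by (auto simp: E_def box_def)
  qed
  then have fE: "finite E" using finite_box[OF assms(1)] finite_subset by blast
  define I where "I = insert None (Some ` E)"
  have "card E < card I"
    using fE by (simp add: I_def card_image card_insert_if)
  then obtain c where c: "\<exists>x\<in>I. c x \<noteq> 0" "\<And>e. e \<in> E \<Longrightarrow> Poly_Mapping.lookup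
      (\<Sum>x\<in>I. const (c x) * (case x of None \<Rightarrow> P | Some a \<Rightarrow> power_prod Q a)) e = 0"
    using polys_dependent_modulo[of E I "\<lambda>x. case x of None \<Rightarrow> P | Some a \<Rightarrow> power_prod Q a"] fE
    by (auto simp: I_def)
  define R where "R = const (c None) * P + (\<Sum>a\<in>E. const (c (Some a)) * power_prod Q a)"
  have RE: "Poly_Mapping.lookup R e = 0" if "e \<in> E" for e
    using c(2)[OF that] fE by (simp add: R_def I_def sum.reindex)
  have Rring: "R \<in> poly_ring V"
  proof -
    have "subst Q (\<Sum>a\<in>E. Poly_Mapping.single a (c (Some a))) \<in> poly_ring V"
    proof (rule subst_in_poly_ring[of _ V])
      show "(\<Sum>a\<in>E. Poly_Mapping.single a (c (Some a))) \<in> poly_ring V"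
        using fE by (auto simp: poly_ring_def in_keys_iff[of _ "sum _ _"] lookup_sum lookup_single
            when_def E_def split: if_splits)
    qed (rule Q(1))
    then show ?thesis
      unfolding R_def
      by (intro poly_ring_add poly_ring_mult P(1) poly_ring_const)
        (simp add: subst_sum subst_single)
  qed
  have "weight_le (\<lambda>_. -1) (d - 1) R"
    unfolding weight_le_def
  proof
    fix a assume a: "a \<in> Poly_Mapping.keys R"
    then have "a \<notin> E" using RE by (auto simp: in_keys_iff)
    then show "wdot a (\<lambda>_. -1) \<le> d - 1"
      using a Rring by (auto simp: E_def poly_ring_def)
  qed
  moreover have "weight_le (\<lambda>_. -1 :: int) (-1) (f i)" if "i \<in> V" for i
    unfolding weight_le_def
  proof
    fix a assume "a \<in> Poly_Mapping.keys (f i)"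
    then have "a \<noteq> 0" using f0[OF that] by (auto simp: in_keys_iff)
    then obtain j where "j \<in> Poly_Mapping.keys a" using keys_eq_empty by blast
    then have "Poly_Mapping.lookup a j \<noteq> 0" by (simp add: in_keys_iff)
    then show "wdot a (\<lambda>_. -1 :: int) \<le> -1" using lookup_le_neg_wdot[of a j] by linarith
  qed
  ultimately have wf: "weight_le (\<lambda>_. -1) (d - 1) (subst f R)"
    using weight_le_subst(1)[OF Rring, of "\<lambda>_. -1" "\<lambda>_. -1"] by blast
  have "subst f R = (\<Sum>a\<in>E. Poly_Mapping.single a (c (Some a)))"
  proof -
    have "power_prod (\<lambda>i. subst f (Q i)) a = Poly_Mapping.single a 1" if "a \<in> E" for a
    proof -
      have "power_prod (\<lambda>i. subst f (Q i)) a = power_prod Var a"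
        using that Q(2) by (intro power_prod_cong) (auto simp: E_def)
      then show ?thesis by (simp add: power_prod_Var)
    qed
    then show ?thesis
      by (simp add: R_def subst_add subst_mult P(2) subst_sum subst_power_prod mult_single)
  qed
  then have look: "Poly_Mapping.lookup (subst f R) a = c (Some a)" if "a \<in> E" for a
    using fE that by (simp add: lookup_sum lookup_single when_def)
  have zero: "c (Some a) = 0" if "a \<in> E" for a
  proof (rule ccontr)
    assume "c (Some a) \<noteq> 0"
    then have "a \<in> Poly_Mapping.keys (subst f R)" using look[OF that] by (simp add: in_keys_iff)
    then show False using wf that by (auto simp: weight_le_def E_def)
  qed
  then have "c None \<noteq> 0" using c(1) by (auto simp: I_def)
  moreover have "b \<in> E" using b P(1) by (auto simp: E_def d_def poly_ring_def)
  moreover have "R = const (c None) * P" using zero by (simp add: R_def)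
  ultimately show False
    using RE[of b] b by (simp add: lookup_const_mult in_keys_iff)
qed

text \<open>The general case reduces to the centred one by translating the origin to the point whose
  coordinates are the constant terms of the \<open>f i\<close>.\<close>

lemma surjective_subst_injective:
  fixes f Q :: "'v \<Rightarrow> ('v, 'k::idom) mpol"
  assumes "finite V"
    and Q: "\<And>i. i \<in> V \<Longrightarrow> Q i \<in> poly_ring V" "\<And>i. i \<in> V \<Longrightarrow> subst f (Q i) = Var i"
    and P: "P \<in> poly_ring V" "subst f P = 0"
  shows "P = 0"
proof -
  define c where "c i = Poly_Mapping.lookup (f i) 0" for i
  define T where "T i = Var i + const (c i)" for i
  define f' where "f' i = f i - const (c i)" for i
  have T: "T i \<in> poly_ring V" if "i \<in> V" for i
    unfolding T_def using that by (intro poly_ring_add poly_ring_Var) auto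
  have shift: "subst f' (subst T p) = subst f p" for p
    by (simp add: subst_subst T_def f'_def subst_add)
  have "subst T P = 0"
  proof (rule surjective_subst_injective_centred[of V "\<lambda>i. subst T (Q i)" f'])
    show "Poly_Mapping.lookup (f' i) 0 = 0" for i
      by (simp add: f'_def lookup_minus c_def)
  qed (use T Q P assms(1) in \<open>auto simp: shift intro: subst_in_poly_ring\<close>)
  then have "subst (\<lambda>i. Var i + const (- c i)) (subst T P) = 0" by simp
  then show ?thesis
    by (simp add: subst_subst T_def subst_add add.assoc single_add[symmetric])
qed

section \<open>Invariants of a deformation of the identity\<close>

text \<open>The images of \<open>g\<close> and \<open>h\<close> are nonzero, since they specialise to \<open>g\<close> and \<open>h\<close> at \<open>t = 0\<close>.
  Their degrees in \<open>t\<close> add up to the degree of \<open>g * h\<close>, which is 0, so the image of \<open>g\<close> does not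
  involve \<open>t\<close> and equals its value \<open>g\<close> at \<open>t = 0\<close>.\<close>

lemma divisor_of_invariant_is_invariant:
  fixes \<Psi> :: "'v::linorder \<Rightarrow> ('v, 'k::idom) mpol"
  assumes \<Psi>: "\<And>i. i \<in> V \<Longrightarrow> hom_part (deg_in t) 0 (\<Psi> i) = Var i"
    and t: "t \<notin> V"
    and gh: "g \<in> poly_ring V" "h \<in> poly_ring V" "g * h \<noteq> 0" "subst \<Psi> (g * h) = g * h"
  shows "subst \<Psi> g = g"
proof -
  have spec: "hom_part (deg_in t) 0 (subst \<Psi> p) = p" if "p \<in> poly_ring V" for p
    using subst_ident[OF that, of "\<lambda>i. subst (Var(t := 0)) (\<Psi> i)"] \<Psi>
    by (simp add: subst_subst flip: subst_zero_hom_part)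
  define G H where "G = subst \<Psi> g" and "H = subst \<Psi> h"
  have "G \<noteq> 0" "H \<noteq> 0"
    using spec gh unfolding G_def H_def by (metis hom_part_0 mult_zero_left mult_zero_right)+
  let ?w = "deg_in t"
  have nonneg: "0 \<le> wdeg ?w p" if "p \<noteq> 0" for p :: "('v, 'k) mpol"
    using wdeg_attained[OF that, of ?w] wdot_deg_in[of _ t] of_nat_0_le_iff by metis
  have "hom_part ?w (wdeg ?w G + wdeg ?w H) (G * H) =
      hom_part ?w (wdeg ?w G) G * hom_part ?w (wdeg ?w H) H"
    by (intro hom_part_mult weight_le_wdeg)
  then have "hom_part ?w (wdeg ?w G + wdeg ?w H) (G * H) \<noteq> 0"
    using hom_part_wdeg_nonzero[OF \<open>G \<noteq> 0\<close>, of ?w]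
      hom_part_wdeg_nonzero[OF \<open>H \<noteq> 0\<close>, of ?w] by simp
  moreover have "weight_le ?w 0 (G * H)"
  proof -
    have "G * H = g * h" using gh(4) by (simp add: G_def H_def subst_mult)
    moreover have "g * h \<in> poly_ring (- {t})"
      using poly_ring_mult[OF gh(1,2)] poly_ring_mono[of V "- {t}"] t by auto
    ultimately show ?thesis by (simp add: weight_le_deg_in_0)
  qed
  ultimately have "wdeg ?w G + wdeg ?w H \<le> 0"
    using hom_part_lower by (metis linorder_not_le)
  then have "wdeg ?w G = 0" using nonneg[OF \<open>G \<noteq> 0\<close>] nonneg[OF \<open>H \<noteq> 0\<close>] by linarith
  then have "weight_le ?w 0 G" using weight_le_wdeg[of ?w G] by simp
  then have "hom_part ?w 0 G = G"
    by (intro hom_part_deg_in_0[of _ "- {t}"]) (auto simp: weight_le_deg_in_0)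
  then show ?thesis using spec[OF gh(1)] by (simp add: G_def)
qed

lemma subst_factor_variable:
  assumes "\<And>a. a \<in> Poly_Mapping.keys p \<Longrightarrow> Poly_Mapping.lookup a x = J"
  shows "subst \<phi> p = \<phi> x ^ J * subst (\<phi>(x := 1)) p"
proof -
  have "Poly_Mapping.keys p \<subseteq> {a. Poly_Mapping.lookup a x = J}" using assms by auto
  then show ?thesis
  proof (induction p rule: poly_mapping_terms_induct)
    case (single a c)
    let ?F = "insert x (Poly_Mapping.keys a)"
    have sup: "power_prod g a = (\<Prod>i\<in>?F. g i ^ Poly_Mapping.lookup a i)"
      for g :: "'a \<Rightarrow> ('c, 'b) mpol"
      by (intro power_prod_superset) auto
    have "(\<Prod>i\<in>?F. \<phi> i ^ Poly_Mapping.lookup a i) =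
        \<phi> x ^ J * (\<Prod>i\<in>?F - {x}. \<phi> i ^ Poly_Mapping.lookup a i)"
      using single by (subst prod.remove[of _ x]) auto
    also have "(\<Prod>i\<in>?F - {x}. \<phi> i ^ Poly_Mapping.lookup a i) =
        (\<Prod>i\<in>?F - {x}. (\<phi>(x := 1)) i ^ Poly_Mapping.lookup a i)"
      by (intro prod.cong) auto
    also have "\<dots> = power_prod (\<phi>(x := 1)) a"
      unfolding sup by (subst (2) prod.remove[of _ x]) auto
    finally have split: "power_prod \<phi> a = \<phi> x ^ J * power_prod (\<phi>(x := 1)) a"
      by (simp add: sup[of \<phi>])
    show ?case
      unfolding subst_single split by (rule mult.left_commute)
  qed (simp_all add: subst_add distrib_left)
qed

text \<open>There is a relation \<open>P\<close> between \<open>r\<close> and the elements of \<open>B\<close>, and \<open>\<Psi>\<close> carries it to a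
  relation between \<open>\<Psi> r\<close> and \<open>B\<close>. If \<open>\<Psi> r\<close> had positive degree in \<open>t\<close>, the highest power of
  \<open>\<Psi> r\<close> would have to cancel by itself, because its coefficient is free of \<open>t\<close>. So this
  coefficient, the value of a nonzero polynomial at \<open>B\<close>, would vanish, against the independence of
  \<open>B\<close>.\<close>

lemma invariants_algebraically_closed:
  fixes \<Psi> :: "'v::linorder \<Rightarrow> ('v, 'k::idom) mpol"
  assumes "finite V" "t \<notin> V"
    and B: "finite B" "B \<subseteq> poly_ring V" "alg_indep B" "card V \<le> card B"
      "\<And>b. b \<in> B \<Longrightarrow> subst \<Psi> b = b"
    and r: "r \<in> poly_ring V"
  shows "weight_le (deg_in t) 0 (subst \<Psi> r)"
proof (rule ccontr)
  assume non: "\<not> weight_le (deg_in t) 0 (subst \<Psi> r)"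
  define s where "s = subst \<Psi> r"
  \<comment> \<open>The variable \<open>None\<close> stands for \<open>r\<close>, and \<open>Some b\<close> for \<open>b\<close>.\<close>
  define U where "U = insert None (Some ` B)"
  define h where "h = case_option r (\<lambda>b. b)"
  define h' where "h' = case_option s (\<lambda>b. b)"
  have "\<exists>P\<in>poly_ring U. P \<noteq> 0 \<and> subst h P = 0"
    using B r assms(1)
    by (intro more_polys_than_variables_dependent[of U V])
      (auto simp: U_def card_image card_insert_if h_def)
  then obtain P where P: "P \<in> poly_ring U" "P \<noteq> 0" "subst h P = 0" by blast
  have "subst h' P = subst (\<lambda>u. subst \<Psi> (h u)) P"
    by (rule subst_cong[OF P(1)]) (auto simp: U_def h_def h'_def s_def B(5))
  then have P': "subst h' P = 0" using P(3) by (simp flip: subst_subst)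
  define e where "e = wdeg (deg_in t) s"
  have "s \<noteq> 0" using non s_def by auto
  have "e > 0"
    using non weight_le_wdeg[of "deg_in t" s] weight_le_mono unfolding e_def s_def
    by (metis linorder_not_le)
  \<comment> \<open>The degrees in \<open>t\<close> of the elements to be inserted in the relation serve as weights of
    its variables.\<close>
  define v where "v = (\<lambda>u::('v, 'k) mpol option. if u = None then e else 0)"
  define q where "q u = hom_part (deg_in t) (v u) (h' u)" for u
  have vle: "weight_le (deg_in t) (v u) (h' u)" if "u \<in> U" for u
  proof (cases u)
    case (Some b)
    then have "b \<in> poly_ring (- {t})"
      using that B(2) poly_ring_mono[of V "- {t}"] assms(2) by (auto simp: U_def)
    then show ?thesis using Some by (simp add: v_def h'_def weight_le_deg_in_0)
  qed (simp add: v_def h'_def e_def weight_le_wdeg)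
  \<comment> \<open>All terms of \<open>P1\<close> contain the variable \<open>None\<close> to the same power \<open>J\<close>, the highest in
    \<open>P\<close>.\<close>
  define P1 where "P1 = hom_part v (wdeg v P) P"
  have P1: "P1 \<in> poly_ring U" "P1 \<noteq> 0"
    by (simp_all add: P1_def P hom_part_poly_ring hom_part_wdeg_nonzero)
  have qP1: "subst q P1 = 0"
    using weight_le_subst(2)[of P U "deg_in t" v h', OF P(1) vle weight_le_wdeg] P'
    by (simp add: P1_def q_def[abs_def])
  obtain a0 where a0: "a0 \<in> Poly_Mapping.keys P1" using P1(2) keys_eq_empty by blast
  define J where "J = Poly_Mapping.lookup a0 None"
  have J: "Poly_Mapping.lookup a None = J" if "a \<in> Poly_Mapping.keys P1" for a
  proof -
    have "wdot a v = wdot a0 v" using that a0 by (auto simp: P1_def keys_hom_part)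
    then show ?thesis
      using \<open>e > 0\<close> by (simp add: v_def wdot_indicator nmul_int J_def)
  qed
  have "q None \<noteq> 0"
    using hom_part_wdeg_nonzero[OF \<open>s \<noteq> 0\<close>] by (simp add: q_def v_def h'_def e_def)
  then have q1: "subst (q(None := 1)) P1 = 0"
    using subst_factor_variable[of P1 None J q, OF J] qP1 by simp
  \<comment> \<open>\<open>P2\<close> is the coefficient of that power, with variables renamed to the elements of \<open>B\<close>.\<close>
  define P2 where "P2 = subst (case_option 1 Var) P1"
  have "P2 \<in> poly_ring B"
    unfolding P2_def
    by (intro subst_in_poly_ring[OF P1(1)]) (auto simp: U_def poly_ring_Var)
  moreover have "subst (\<lambda>b. b) P2 = 0"
  proof -
    have "subst (\<lambda>b. b) P2 = subst (q(None := 1)) P1"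
      unfolding P2_def subst_subst
    proof (rule subst_cong[OF P1(1)])
      fix u assume "u \<in> U"
      then show "subst (\<lambda>b. b) (case_option 1 Var u) = (q(None := 1)) u"
        using hom_part_deg_in_0[OF subsetD[OF B(2)] assms(2)]
        by (auto simp: U_def q_def v_def h'_def)
    qed
    then show ?thesis using q1 by simp
  qed
  ultimately have "P2 = 0" using B(3) by (auto simp: alg_indep_def)
  then have "subst (\<lambda>b. Var (Some b)) P2 = 0" by simp
  moreover have "subst (\<lambda>b. Var (Some b)) P2 = subst (Var(None := 1)) P1"
    unfolding P2_def subst_subst by (rule subst_cong[OF P1(1)]) (auto simp: U_def)
  ultimately have "P1 = 0"
    using subst_factor_variable[of P1 None J Var, OF J] by simp
  then show False using P1(2) by simp
qed

lemma trdeg_attained: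
  assumes "trdeg A = enat n" "1 \<le> n"
  shows "\<exists>B\<subseteq>A. finite B \<and> alg_indep B \<and> n \<le> card B"
proof (rule ccontr)
  assume "\<not> ?thesis"
  then have "card B \<le> n - 1" if "B \<subseteq> A" "finite B" "alg_indep B" for B
    using that by fastforce
  then have "trdeg A \<le> enat (n - 1)"
    unfolding trdeg_def by (intro SUP_least) auto
  then show False using assms by simp
qed

section \<open>The initial form of a deformation\<close>

text \<open>A minimum of the slopes \<open>x \<tau> / j \<tau>\<close>. These live in the divisible hull of the group; comparing
  them after multiplication by the denominators keeps everything inside the group.\<close>

lemma least_slope_exists:
  fixes x :: "'i \<Rightarrow> 'g::linordered_ab_group_add"
  assumes "finite T" "T \<noteq> {}" "\<And>\<tau>. \<tau> \<in> T \<Longrightarrow> 0 < j \<tau>"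
  shows "\<exists>\<sigma>\<in>T. \<forall>\<tau>\<in>T. nmul (j \<tau>) (x \<sigma>) \<le> nmul (j \<sigma>) (x \<tau>)"
  using assms
proof (induction T rule: finite_ne_induct)
  case (singleton \<tau>)
  then show ?case by simp
next
  case (insert \<rho> T)
  then obtain \<sigma> where \<sigma>: "\<sigma> \<in> T" "\<And>\<tau>. \<tau> \<in> T \<Longrightarrow> nmul (j \<tau>) (x \<sigma>) \<le> nmul (j \<sigma>) (x \<tau>)"
    by auto
  show ?case
  proof (cases "nmul (j \<rho>) (x \<sigma>) \<le> nmul (j \<sigma>) (x \<rho>)")
    case True
    then show ?thesis using \<sigma> by (intro bexI[of _ \<sigma>]) auto
  next
    case False
    then have less: "nmul (j \<sigma>) (x \<rho>) \<le> nmul (j \<rho>) (x \<sigma>)" by simp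
    have "nmul (j \<tau>) (x \<rho>) \<le> nmul (j \<rho>) (x \<tau>)" if "\<tau> \<in> T" for \<tau>
    proof -
      have "nmul (j \<sigma>) (nmul (j \<tau>) (x \<rho>)) = nmul (j \<tau>) (nmul (j \<sigma>) (x \<rho>))"
        by (rule nmul_commute)
      also have "\<dots> \<le> nmul (j \<tau>) (nmul (j \<rho>) (x \<sigma>))" by (rule nmul_mono[OF less])
      also have "\<dots> = nmul (j \<rho>) (nmul (j \<tau>) (x \<sigma>))" by (rule nmul_commute)
      also have "\<dots> \<le> nmul (j \<rho>) (nmul (j \<sigma>) (x \<tau>))" by (rule nmul_mono[OF \<sigma>(2)[OF that]])
      also have "\<dots> = nmul (j \<sigma>) (nmul (j \<rho>) (x \<tau>))" by (rule nmul_commute)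
      finally show ?thesis
        using insert.prems \<sigma>(1) by (simp add: nmul_le_iff)
    qed
    then show ?thesis by (intro bexI[of _ \<rho>]) auto
  qed
qed

text \<open>A term of \<open>\<Phi> i\<close> with exponent vector \<open>c\<close> and positive degree \<open>c t\<close> in \<open>t\<close> does not exceed the weight
  of \<open>i\<close> if and only if the weight of \<open>t\<close> is at most \<open>(w i - c \<cdot> w) / c t\<close>, where \<open>c \<cdot> w\<close> leaves \<open>t\<close> out.
  The weight of \<open>t\<close> is the least of these slopes. It need not exist in the group, so all
  weights are multiplied by the denominator \<open>N\<close> of the least slope; by torsion freeness this
  changes no initial form.\<close>

lemma initial_form_of_deformation:
  fixes \<Phi> :: "'v \<Rightarrow> ('v, 'k::idom) mpol" and w :: "'v \<Rightarrow> 'g::linordered_ab_group_add"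
  assumes "finite V" "t \<notin> V"
    and \<Phi>: "\<And>i. i \<in> V \<Longrightarrow> hom_part (deg_in t) 0 (\<Phi> i) = Var i"
    and nontrivial: "\<exists>i\<in>V. \<Phi> i \<noteq> Var i"
  shows "\<exists>\<Psi>. (\<forall>i\<in>V. hom_part (deg_in t) 0 (\<Psi> i) = Var i) \<and>
    (\<exists>i\<in>V. \<not> weight_le (deg_in t) 0 (\<Psi> i)) \<and>
    (\<forall>p\<in>poly_ring V. p \<noteq> 0 \<longrightarrow> subst \<Phi> p = p \<longrightarrow>
       subst \<Psi> (initial_form w p) = initial_form w p)"
proof -
  define T where "T = (SIGMA i:V. {c \<in> Poly_Mapping.keys (\<Phi> i). 0 < Poly_Mapping.lookup c t})"
  define w0 where "w0 = w(t := 0)"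
  define j where "j = (\<lambda>(i :: 'v, c :: 'v \<Rightarrow>\<^sub>0 nat). Poly_Mapping.lookup c t)"
  define x where "x = (\<lambda>(i, c). w i - wdot c w0)"
  have "T \<noteq> {}"
  proof
    assume "T = {}"
    then have "\<Phi> i \<in> poly_ring (- {t})" if "i \<in> V" for i
      using that by (auto simp: T_def poly_ring_def in_keys_iff[of t])
    then have "\<Phi> i = Var i" if "i \<in> V" for i
      using \<Phi>[OF that] hom_part_deg_in_0[of "\<Phi> i" "- {t}" t] that by auto
    then show False using nontrivial by blast
  qed
  moreover have "finite T" using assms(1) by (simp add: T_def)
  moreover have "0 < j \<tau>" if "\<tau> \<in> T" for \<tau> using that by (auto simp: T_def j_def)
  ultimately obtain \<sigma> where \<sigma>: "\<sigma> \<in> T" "\<And>\<tau>. \<tau> \<in> T \<Longrightarrow> nmul (j \<tau>) (x \<sigma>) \<le> nmul (j \<sigma>) (x \<tau>)"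
    using least_slope_exists[of T j x] by blast
  obtain i0 c0 where s: "\<sigma> = (i0, c0)" by force
  define N where "N = j \<sigma>"
  define w' where "w' = (\<lambda>i. if i = t then x \<sigma> else nmul N (w i))"
  have N: "0 < N" using \<sigma>(1) by (auto simp: N_def T_def j_def)
  have w'dot: "wdot c w' = nmul (Poly_Mapping.lookup c t) (x \<sigma>) + nmul N (wdot c w0)" for c
  proof -
    have "w' = (\<lambda>i. (if i = t then x \<sigma> else 0) + nmul N (w0 i))"
      by (auto simp: w'_def w0_def)
    then show ?thesis by (simp add: wdot_weight_add wdot_indicator wdot_nmul)
  qed
  have w'V: "w' i = nmul N (w i)" if "i \<in> V" for i
    using that assms(2) by (auto simp: w'_def)
  have le: "weight_le w' (w' i) (\<Phi> i)" if i: "i \<in> V" for i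
    unfolding weight_le_def
  proof
    fix c assume c: "c \<in> Poly_Mapping.keys (\<Phi> i)"
    show "wdot c w' \<le> w' i"
    proof (cases "Poly_Mapping.lookup c t = 0")
      case True
      then have "c \<in> Poly_Mapping.keys (hom_part (deg_in t) 0 (\<Phi> i))"
        using c by (simp add: keys_hom_part wdot_deg_in)
      \<comment> \<open>The terms free of \<open>t\<close> make up the value at \<open>t = 0\<close>, which is the variable \<open>i\<close>.\<close>
      then have "c = Poly_Mapping.single i 1" by (simp add: \<Phi>[OF i] Var_def)
      then show ?thesis by (simp add: wdot_single)
    next
      case False
      then have "(i, c) \<in> T" using i c by (simp add: T_def)
      from \<sigma>(2)[OF this] have "nmul (Poly_Mapping.lookup c t) (x \<sigma>) \<le> nmul N (w i - wdot c w0)"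
        by (simp add: j_def x_def N_def)
      then show ?thesis by (simp add: w'dot w'V i nmul_diff algebra_simps)
    qed
  qed
  define \<Psi> where "\<Psi> i = hom_part w' (w' i) (\<Phi> i)" for i
  have "hom_part (deg_in t) 0 (\<Psi> i) = Var i" if "i \<in> V" for i
    by (simp add: \<Psi>_def hom_part_commute[of "deg_in t"] \<Phi>[OF that])
      (simp add: Var_def hom_part_single wdot_single)
  moreover have "\<exists>i\<in>V. \<not> weight_le (deg_in t) 0 (\<Psi> i)"
  proof -
    have c0: "i0 \<in> V" "c0 \<in> Poly_Mapping.keys (\<Phi> i0)" "0 < Poly_Mapping.lookup c0 t"
      using \<sigma>(1) by (auto simp: s T_def)
    have "wdot c0 w' = w' i0"
      using c0 by (simp add: w'dot w'V) (simp add: N_def j_def s x_def nmul_diff)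
    then have "c0 \<in> Poly_Mapping.keys (\<Psi> i0)" using c0 by (simp add: \<Psi>_def keys_hom_part)
    then show ?thesis using c0 by (force simp: weight_le_def wdot_deg_in)
  qed
  moreover have "subst \<Psi> (initial_form w p) = initial_form w p"
    if p: "p \<in> poly_ring V" "p \<noteq> 0" "subst \<Phi> p = p" for p
  proof -
    define d where "d = nmul N (wdeg w p)"
    have dot: "wdot a w' = nmul N (wdot a w)" if "a \<in> Poly_Mapping.keys p" for a
    proof -
      have "wdot a w' = wdot a (\<lambda>i. nmul N (w i))"
        using that p(1) by (intro wdot_cong w'V) (auto simp: poly_ring_def)
      then show ?thesis by (simp add: wdot_nmul)
    qed
    have "weight_le w' d p"
      using weight_le_wdeg[of w p] by (simp add: weight_le_def dot d_def nmul_mono)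
    then have "hom_part w' d (subst \<Phi> p) = subst \<Psi> (hom_part w' d p)"
      using weight_le_subst(2)[of p V w' w' \<Phi> d, OF p(1) le] by (simp add: \<Psi>_def[abs_def])
    moreover have "hom_part w' d p = initial_form w p"
    proof -
      have "{a \<in> Poly_Mapping.keys p. wdot a w' = d} =
          {a \<in> Poly_Mapping.keys p. wdot a w = wdeg w p}"
        using dot N by (auto simp: d_def nmul_eq_iff)
      then show ?thesis by (simp add: initial_form_def hom_part_def)
    qed
    ultimately show ?thesis using p(3) by simp
  qed
  ultimately show ?thesis by blast
qed

section \<open>Translation along one generator\<close>

text \<open>\<open>Q\<close> is the inverse of \<open>f\<close>, on both sides by injectivity, and \<open>\<Phi>\<close> is the translation
  of the coordinate \<open>f j\<close> by \<open>t\<close>, written in the variables. If it fixes the variable \<open>i\<close>, then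
  \<open>Q i\<close> is constant in the direction of translation, so it does not involve the variable \<open>j\<close>, and
  inserting \<open>f\<close> in \<open>Q i\<close> expresses the variable \<open>i\<close> by the other generators.\<close>

lemma translation_of_coordinate:
  fixes f :: "'v \<Rightarrow> ('v, 'k::idom) mpol"
  assumes "finite W" "t \<notin> W" "j \<in> W"
    and f: "\<And>i. i \<in> W \<Longrightarrow> f i \<in> poly_ring W" "poly_ring W \<subseteq> subalg (f ` W)"
  shows "\<exists>\<Phi>. (\<forall>i\<in>W. hom_part (deg_in t) 0 (\<Phi> i) = Var i) \<and>
    (\<forall>p\<in>subalg (f ` (W - {j})). subst \<Phi> p = p) \<and>
    (\<forall>i\<in>W. \<Phi> i = Var i \<longrightarrow> Var i \<in> subalg (f ` (W - {j})))"
proof -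
  have "\<exists>q\<in>poly_ring W. subst f q = Var i" if "i \<in> W" for i
    using f(2) poly_ring_Var[OF that] subalg_image_subst by blast
  then obtain Q where Q: "\<And>i. i \<in> W \<Longrightarrow> Q i \<in> poly_ring W" "\<And>i. i \<in> W \<Longrightarrow> subst f (Q i) = Var i"
    by metis
  have Qf: "subst Q (f i) = Var i" if "i \<in> W" for i
  proof -
    have "subst f (subst Q (f i)) = f i"
      unfolding subst_subst by (rule subst_ident[OF f(1)[OF that]]) (rule Q(2))
    then have "subst f (subst Q (f i) - Var i) = 0"
      by (simp add: subst_diff)
    moreover have "subst Q (f i) - Var i \<in> poly_ring W"
      using subst_in_poly_ring[OF f(1)[OF that] Q(1)] poly_ring_Var[OF that]
      by (rule poly_ring_diff)
    ultimately have "subst Q (f i) - Var i = 0"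
      using surjective_subst_injective[OF assms(1) Q] by blast
    then show ?thesis by simp
  qed
  define e where "e = f(j := f j + Var t)"
  define \<Phi> where "\<Phi> i = subst e (Q i)" for i
  have t0: "subst (Var(t := 0)) p = p" if "p \<in> poly_ring W" for p :: "('v, 'k) mpol"
    using that by (rule subst_ident) (use assms(2) in auto)
  have "hom_part (deg_in t) 0 (\<Phi> i) = Var i" if i: "i \<in> W" for i
  proof -
    have "subst (Var(t := 0)) (\<Phi> i) = subst f (Q i)"
      unfolding \<Phi>_def subst_subst
      by (rule subst_cong[OF Q(1)[OF i]]) (use assms(3) f(1) in \<open>auto simp: e_def subst_add t0\<close>)
    then show ?thesis by (simp add: Q(2)[OF i] subst_zero_hom_part)
  qed
  moreover have "subst \<Phi> p = p" if "p \<in> subalg (f ` (W - {j}))" for p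
  proof -
    obtain q where q: "q \<in> poly_ring (W - {j})" "subst f q = p"
      using subalg_image_subst[OF \<open>p \<in> _\<close>] by blast
    have "subst Q p = q"
      unfolding q(2)[symmetric] subst_subst by (rule subst_ident[OF q(1)]) (simp add: Qf)
    then have "subst \<Phi> p = subst e q"
      by (simp add: \<Phi>_def[abs_def] flip: subst_subst)
    also have "\<dots> = subst f q"
      by (rule subst_cong[OF q(1)]) (auto simp: e_def)
    finally show ?thesis using q(2) by simp
  qed
  moreover have "Var i \<in> subalg (f ` (W - {j}))" if i: "i \<in> W" and inv: "\<Phi> i = Var i" for i
  proof -
    \<comment> \<open>\<open>\<theta>\<close> sends the coordinate \<open>f j\<close> to 0 and \<open>t\<close> to the variable \<open>j\<close>. So \<open>f j + t\<close>
      goes to the variable \<open>j\<close>, as \<open>f j\<close> does under \<open>Q\<close>.\<close>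
    define \<theta> where "\<theta> = (\<lambda>l. if l = t then Var j else subst (Var(j := 0)) (Q l))"
    have \<theta>f: "subst \<theta> (f l) = (Var(j := 0)) l" if "l \<in> W" for l
    proof -
      have "subst \<theta> (f l) = subst (Var(j := 0)) (subst Q (f l))"
        unfolding subst_subst
        by (rule subst_cong[OF f(1)[OF that]]) (use assms(2) in \<open>auto simp: \<theta>_def\<close>)
      then show ?thesis by (simp add: Qf[OF that])
    qed
    have \<theta>t: "\<theta> t = Var j" by (simp add: \<theta>_def)
    have "subst \<theta> (\<Phi> i) = Q i"
      unfolding \<Phi>_def subst_subst
      by (rule subst_ident[OF Q(1)[OF i]]) (use assms(3) \<theta>t in \<open>auto simp: e_def subst_add \<theta>f\<close>)
    moreover have "subst \<theta> (Var i) = subst (Var(j := 0)) (Q i)"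
      using i assms(2) by (auto simp: \<theta>_def)
    ultimately have Qi: "Q i = subst (Var(j := 0)) (Q i)" using inv by simp
    have "subst (Var(j := 0)) (Q i) \<in> poly_ring (W - {j})"
      by (intro subst_in_poly_ring[OF Q(1)[OF i]]) (auto simp: poly_ring_Var)
    then have "Q i \<in> poly_ring (W - {j})" using Qi by simp
    then have "subst f (Q i) \<in> subalg (f ` (W - {j}))"
      by (rule subst_in_subalg) (auto intro: subalg.gen)
    then show ?thesis by (simp add: Q(2)[OF i])
  qed
  ultimately show ?thesis by (intro exI[of _ \<Phi>]) blast
qed

section \<open>Divisors of initial forms\<close>

theorem theorem1p4:
  fixes n m :: nat
    and f :: "nat \<Rightarrow> (nat, 'k::idom) mpol"
    and S :: "(nat, 'k) mpol set"
    and w :: "nat \<Rightarrow> 'g::linordered_ab_group_add"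
  assumes "1 \<le> n" and "n \<le> m"
    and "\<And>i. i \<in> {1..m} \<Longrightarrow> f i \<in> poly_ring {1..m}"
    and "subalg (f ` {1..m}) = poly_ring {1..m}"
    and "\<not> poly_ring {1..n} \<subseteq> subalg (f ` {2..m})"
    and "S \<subseteq> poly_ring {1..n} - {0}"
    and "trdeg (subalg S) = enat n"
  shows "\<exists>g \<in> S. \<forall>p \<in> (subalg (f ` {2..m}) \<inter> poly_ring {1..n}) - {0}.
           \<not> dvd_in (poly_ring {1..n}) g (initial_form w p)"
proof (rule ccontr)
  let ?V = "{1..n}" and ?A = "subalg (f ` {2..m})"
  assume "\<not> ?thesis"
  then have dvd: "\<exists>p\<in>(?A \<inter> poly_ring ?V) - {0}. dvd_in (poly_ring ?V) g (initial_form w p)"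
    if "g \<in> S" for g
    using that by blast
  \<comment> \<open>The variable with index 0 is free to serve as \<open>t\<close>.\<close>
  have "{1..m} - {1} = {2..m}" by auto
  then have "\<exists>\<Phi>. (\<forall>i\<in>{1..m}. hom_part (deg_in 0) 0 (\<Phi> i) = Var i) \<and>
      (\<forall>p\<in>?A. subst \<Phi> p = p) \<and> (\<forall>i\<in>{1..m}. \<Phi> i = Var i \<longrightarrow> Var i \<in> ?A)"
    using translation_of_coordinate[of "{1..m}" 0 1 f] assms(1-4) by simp
  then obtain \<Phi> where \<Phi>: "\<And>i. i \<in> {1..m} \<Longrightarrow> hom_part (deg_in 0) 0 (\<Phi> i) = Var i"
    "\<And>p. p \<in> ?A \<Longrightarrow> subst \<Phi> p = p" "\<And>i. i \<in> {1..m} \<Longrightarrow> \<Phi> i = Var i \<Longrightarrow> Var i \<in> ?A"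
    by blast
  have "\<exists>i\<in>?V. \<Phi> i \<noteq> Var i"
  proof (rule ccontr)
    assume "\<not> ?thesis"
    then have "Var i \<in> ?A" if "i \<in> ?V" for i using \<Phi>(3)[of i] that assms(2) by auto
    then have "p \<in> ?A" if "p \<in> poly_ring ?V" for p
      using subst_in_subalg[OF that, of Var "f ` {2..m}"] by simp
    then show False using assms(5) by blast
  qed
  moreover have "hom_part (deg_in 0) 0 (\<Phi> i) = Var i" if "i \<in> ?V" for i
    using \<Phi>(1)[of i] that assms(2) by simp
  ultimately have "\<exists>\<Psi>. (\<forall>i\<in>?V. hom_part (deg_in 0) 0 (\<Psi> i) = Var i) \<and>
    (\<exists>i\<in>?V. \<not> weight_le (deg_in 0) 0 (\<Psi> i)) \<and>
    (\<forall>p\<in>poly_ring ?V. p \<noteq> 0 \<longrightarrow> subst \<Phi> p = p \<longrightarrow>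
       subst \<Psi> (initial_form w p) = initial_form w p)"
    by (intro initial_form_of_deformation) auto
  then obtain \<Psi> where \<Psi>: "\<And>i. i \<in> ?V \<Longrightarrow> hom_part (deg_in 0) 0 (\<Psi> i) = Var i"
    "\<exists>i\<in>?V. \<not> weight_le (deg_in 0) 0 (\<Psi> i)"
    "\<And>p. p \<in> poly_ring ?V \<Longrightarrow> p \<noteq> 0 \<Longrightarrow> subst \<Phi> p = p \<Longrightarrow>
       subst \<Psi> (initial_form w p) = initial_form w p"
    by blast
  have S: "subst \<Psi> g = g" if g: "g \<in> S" for g
  proof -
    obtain p h where p: "p \<in> ?A" "p \<in> poly_ring ?V" "p \<noteq> 0"
      and h: "h \<in> poly_ring ?V" "initial_form w p = g * h"
      using dvd[OF g] by (auto simp: dvd_in_def)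
    have "initial_form w p \<noteq> 0"
      using hom_part_wdeg_nonzero[OF p(3)] by (simp add: initial_form_hom_part)
    then show ?thesis
      using divisor_of_invariant_is_invariant[of ?V 0 \<Psi> g h] \<Psi>(1) \<Psi>(3)[OF p(2,3) \<Phi>(2)[OF p(1)]]
        g h assms(6) by auto
  qed
  have inv: "p \<in> poly_ring ?V \<and> subst \<Psi> p = p" if "p \<in> subalg S" for p
    using that
    by induction (use S assms(6) in \<open>auto intro: poly_ring_add poly_ring_mult simp: subst_add subst_mult\<close>)
  obtain B where B: "B \<subseteq> subalg S" "finite B" "alg_indep B" "n \<le> card B"
    using trdeg_attained[OF assms(7,1)] by blast
  have "weight_le (deg_in 0) 0 (\<Psi> i)" if "i \<in> ?V" for i
    using invariants_algebraically_closed[of ?V 0 B \<Psi> "Var i"] B inv poly_ring_Var[OF that]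
    by auto
  then show False using \<Psi>(2) by blast
qed

end
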